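(* Every $\mathcal{C}$-adic word $\mathbf{w}$ with directive sequence $(\sigma_n)_{n\in\mathbb{N}}\in\mathcal{C}^{\mathbb{N}}$ has uniform word frequencies. In particular, if $\mathbf{f}\in\mathbb{R}^3_{\ge0}$ is such that $\|\mathbf{f}\|_1=1$ and $$\bigcap_{n\ge0}M_{\sigma_{[0,n)}}\mathbb{R}^3_{\ge0}=\mathbb{R}_{\ge0}\mathbf{f},$$ then $\mathbf{f}$ is the vector of letter frequencies of $\mathbf{w}$.
   Context: Let $\mathcal{A}=\{1,2,3\}$ and $\mathcal{C}=\{c_1,c_2\}$, where $c_1,c_2$ are the endomorphisms of the free monoid $\mathcal{A}^*$ given by $c_1:1\mapsto1,\ 2\mapsto13,\ 3\mapsto2$ and $c_2:1\mapsto2,\ 2\mapsto13,\ 3\mapsto3$. Write $\sigma_{[0,n)}=\sigma_0\sigma_1\cdots\sigma_{n-1}$. An infinite word $\mathbf{w}\in\mathcal{A}^{\mathbb{N}}$ is $\mathcal{C}$-adic with directive sequence $(\sigma_n)_n\in\mathcal{C}^{\mathbb{N}}$ if there is a sequence of letters $(a_n)_n\in\mathcal{A}^{\mathbb{N}}$ such that $\lim_{n\to\infty}\sigma_{[0,n)}(a_n)$ exists and equals $\mathbf{w}$. The incidence matrix of a substitution $\sigma$ is $M_\sigma=(|\sigma(b)|_a)_{a,b\in\mathcal{A}}$ ($a$ row index, $b$ column index), where $|v|_u$ denotes the number of occurrences of $u$ in $v$. The word $\mathbf{w}=w_0w_1w_2\cdots$ has uniform word frequencies if for every $u\in\mathcal{A}^*$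 the ratio $|w_kw_{k+1}\cdots w_{k+n-1}|_u/n$ converges as $n\to\infty$, uniformly in $k$. The vector of letter frequencies is $(f_1,f_2,f_3)$ with $f_a=\lim_{n\to\infty}|w_0\cdots w_{n-1}|_a/n$. *)

theory Defs
  imports "HOL-Analysis.Analysis"
begin

text \<open>The alphabet is the three-element type \<open>3\<close>, whose elements are \<open>1, 2, 3\<close>
  (in this type \<open>3 = 0\<close>). The free monoid over it is \<open>3 list\<close>,
  and infinite words are functions \<open>nat \<Rightarrow> 3\<close>.\<close>

type_synonym letter = 3
type_synonym word = "letter list"
type_synonym subst = "word \<Rightarrow> word"

definition endo :: "(letter \<Rightarrow> word) \<Rightarrow> subst" where
  "endo h v = concat (map h v)"

definition c1 :: subst where
  "c1 = endo (\<lambda>a. if a = 1 then [1] else if a = 2 then [1, 3] else [2])"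

definition c2 :: subst where
  "c2 = endo (\<lambda>a. if a = 1 then [2] else if a = 2 then [1, 3] else [3])"

lemma endo_append: "endo h (u @ v) = endo h u @ endo h v"
  by (simp add: endo_def)

lemma c1_letter: "c1 [1] = [1]" "c1 [2] = [1, 3]" "c1 [3] = [2]"
  by (simp_all add: c1_def endo_def)

lemma c2_letter: "c2 [1] = [2]" "c2 [2] = [1, 3]" "c2 [3] = [3]"
  by (simp_all add: c2_def endo_def)

primrec subst_prod :: "(nat \<Rightarrow> subst) \<Rightarrow> nat \<Rightarrow> subst" where
  "subst_prod \<sigma> 0 = id"
| "subst_prod \<sigma> (Suc n) = subst_prod \<sigma> n \<circ> \<sigma> n"

text \<open>Convergence of finite words to an infinite word: every prefix is eventually constant.
  Since \<open>take k v\<close> has length \<open>k\<close> only if \<open>v\<close> is long enough, this forces the lengths to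
  tend to infinity.\<close>

definition words_tendsto :: "(nat \<Rightarrow> word) \<Rightarrow> (nat \<Rightarrow> letter) \<Rightarrow> bool" where
  "words_tendsto v w \<longleftrightarrow> (\<forall>k. \<forall>\<^sub>F n in sequentially. take k (v n) = map w [0..<k])"

definition C_adic :: "(nat \<Rightarrow> subst) \<Rightarrow> (nat \<Rightarrow> letter) \<Rightarrow> bool" where
  "C_adic \<sigma> w \<longleftrightarrow> (\<forall>n. \<sigma> n \<in> {c1, c2}) \<and>
     (\<exists>a :: nat \<Rightarrow> letter. words_tendsto (\<lambda>n. subst_prod \<sigma> n [a n]) w)"

text \<open>Occurrences may overlap.\<close>

definition occ :: "word \<Rightarrow> word \<Rightarrow> nat" where
  "occ u v = card {i. i + length u \<le> length v \<and> take (length u) (drop i v) = u}"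

definition incidence :: "subst \<Rightarrow> real ^ letter ^ letter" where
  "incidence s = (\<chi> a b. real (occ [a] (s [b])))"

text \<open>The limit does not depend on \<open>k\<close>: for fixed \<open>u\<close>, the ratios for \<open>k\<close> and \<open>k'\<close> differ by
  at most \<open>2 * \<bar>k - k'\<bar> / n\<close>.\<close>

definition uniform_word_frequencies :: "(nat \<Rightarrow> letter) \<Rightarrow> bool" where
  "uniform_word_frequencies w \<longleftrightarrow>
     (\<forall>u. \<exists>l :: real. uniform_limit UNIV
        (\<lambda>n k. real (occ u (map w [k..<k + n])) / real n) (\<lambda>k. l) sequentially)"

definition is_letter_frequency_vector :: "(nat \<Rightarrow> letter) \<Rightarrow> real ^ letter \<Rightarrow> bool" where
  "is_letter_frequency_vector w f \<longleftrightarrow>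
     (\<forall>a. (\<lambda>n. real (occ [a] (map w [0..<n])) / real n) \<longlonglongrightarrow> f $ a)"

definition nonneg_orthant :: "(real ^ letter) set" where
  "nonneg_orthant = {x. \<forall>a. 0 \<le> x $ a}"

end

theory Submission
  imports Defs
begin

text \<open>The lengths \<open>(x, y, z)\<close> of the images of \<open>1, 2, 3\<close> under \<open>\<sigma>\<^sub>0 \<cdots> \<sigma>\<^sub>n\<^sub>-\<^sub>1\<close> become
  \<open>(x, x + z, y)\<close> or \<open>(y, x + z, z)\<close> in the next step, and so does every additive weight; the
  inequalities \<open>max x z \<le> y \<le> x + z\<close> persist. Right after \<open>\<sigma>\<close> switches between \<open>c\<^sub>1\<close> and \<open>c\<^sub>2\<close>
  the three lengths agree up to a factor 2, and any four further substitutions produce images that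
  share a letter. Hence the spread of the ratios weight/length shrinks by the factor 31/32 within
  six steps of each switch. If switches occur forever, then the lengths also tend to infinity, and applying this
  to the weight counting occurrences of \<open>u\<close> shows that the images of all letters are blocks with
  nearly the same frequency of \<open>u\<close>. Otherwise \<open>\<sigma>\<close> is eventually constant and the blocks are images
  of powers of a single letter. In both cases every window of \<open>w\<close> is a concatenation
  of such blocks up to bounded ends. Finally, the vector of letter frequencies lies in every cone of
  the given intersection, because these cones are closed.\<close>

section \<open>Counting occurrences\<close>

lemma finite_occ: "finite {i. i + length u \<le> length v \<and> take (length u) (drop i v) = u}"
  by (rule finite_subset[of _ "{..length v}"]) auto

text \<open>The extra 1 is attained by the empty word, which occurs at \<open>length v + 1\<close>
  positions.\<close>

lemma occ_le: "occ u v \<le> length v + 1"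
proof -
  have "occ u v \<le> card {..length v}"
    unfolding occ_def by (rule card_mono) auto
  then show ?thesis by simp
qed

text \<open>An occurrence in \<open>x @ y\<close> lies inside \<open>x\<close>, starts in
  \<open>y\<close>, or starts among the last \<open>length u\<close> positions of \<open>x\<close>.
  Conversely, an occurrence is counted for both parts only if \<open>u\<close> is empty, at the
  junction, which costs at most 1.\<close>

lemma occ_append:
  "occ u (x @ y) \<le> occ u x + occ u y + length u + 1"
  "occ u x + occ u y \<le> occ u (x @ y) + length u + 1"
proof -
  define P where "P v = {i. i + length u \<le> length v \<and> take (length u) (drop i v) = u}" for v
  have fin: "finite (P v)" for v unfolding P_def by (rule finite_occ)
  \<comment> \<open>\<open>?S\<close> holds the occurrences inside \<open>y\<close>, shifted;
    \<open>?M\<close> contains every position from which \<open>u\<close> can cross the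
    junction.\<close>
  let ?S = "(\<lambda>i. i + length x) ` P y" and ?M = "{length x - length u..<length x}"
  have occ: "occ u v = card (P v)" for v by (simp add: occ_def P_def)
  have cS: "card ?S = card (P y)" by (rule card_image) auto
  have 1: "P (x @ y) \<subseteq> P x \<union> ?S \<union> ?M"
  proof
    fix i assume i: "i \<in> P (x @ y)"
    consider "i + length u \<le> length x" | "length x \<le> i" | "i \<in> ?M" by fastforce
    then show "i \<in> P x \<union> ?S \<union> ?M"
    proof cases
      case 2
      then have "i - length x \<in> P y" using i by (auto simp: P_def)
      then have "i - length x + length x \<in> ?S" by blast
      then show ?thesis using 2 by simp
    qed (use i in \<open>auto simp: P_def\<close>)
  qed
  have "card (P (x @ y)) \<le> card (P x \<union> ?S \<union> ?M)"
    by (rule card_mono[OF _ 1]) (simp add: fin)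
  also have "\<dots> \<le> card (P x) + card ?S + card ?M"
    by (intro order_trans[OF card_Un_le] add_right_mono card_Un_le)
  finally show "occ u (x @ y) \<le> occ u x + occ u y + length u + 1"
    unfolding occ cS by simp
  have 2: "P x \<union> ?S \<subseteq> P (x @ y)" by (auto simp: P_def)
  have 3: "P x \<inter> ?S \<subseteq> {length x}" by (auto simp: P_def)
  have "card (P x) + card ?S = card (P x \<union> ?S) + card (P x \<inter> ?S)"
    by (rule card_Un_Int) (auto simp: fin)
  also have "\<dots> \<le> card (P (x @ y)) + card {length x}"
    by (intro add_mono card_mono 2 3) (auto simp: fin)
  finally show "occ u x + occ u y \<le> occ u (x @ y) + length u + 1"
    unfolding occ cS by simp
qed

lemma occ_append_abs:
  "\<bar>real (occ u (x @ y)) - real (occ u x) - real (occ u y)\<bar> \<le> real (length u) + 1"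
  using occ_append[of u x y] by linarith

text \<open>The final 1 serves the empty list, since the empty word occurs once in
  \<open>[]\<close>.\<close>

lemma occ_concat:
  "\<bar>real (occ u (concat Bs)) - (\<Sum>B\<leftarrow>Bs. real (occ u B))\<bar>
     \<le> (real (length u) + 1) * real (length Bs) + 1"
proof (induction Bs)
  case Nil
  show ?case using occ_le[of u "[]"] by simp
next
  case (Cons B Bs)
  then show ?case using occ_append_abs[of u B "concat Bs"] by (simp add: algebra_simps)
qed

lemma occ_singleton: "occ [a] v = count_list v a"
proof -
  have "{i. i + length [a] \<le> length v \<and> take (length [a]) (drop i v) = [a]}
      = {i. i < length v \<and> v ! i = a}"
    by (auto simp: take_Suc hd_drop_conv_nth Suc_le_eq)
  then have "occ [a] v = length (filter (\<lambda>x. x = a) v)"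
    by (simp add: occ_def length_filter_conv_card)
  also have "\<dots> = count_list v a" by (induction v) auto
  finally show ?thesis .
qed

section \<open>Uniform frequencies from decompositions into blocks\<close>

text \<open>\<open>L\<close> may depend on \<epsilon>, so no limit is given in advance. The ratios
  for \<open>k = 0\<close> form a Cauchy sequence, and its limit is compared with the ratios for all
  \<open>k\<close> through \<open>L\<close>.\<close>

lemma uniform_limit_ratio:
  fixes F :: "nat \<Rightarrow> nat \<Rightarrow> real"
  assumes "\<And>\<epsilon>. \<epsilon> > 0 \<Longrightarrow> \<exists>L C. \<forall>k n. \<bar>F k n - L * real n\<bar> \<le> \<epsilon> * real n + C"
  shows "\<exists>l. uniform_limit UNIV (\<lambda>n k. F k n / real n) (\<lambda>k. l) sequentially"
proof -
  have ex: "\<exists>L N. \<forall>k. \<forall>n\<ge>N. \<bar>F k n / real n - L\<bar> < \<epsilon>" if eps: "\<epsilon> > 0" for \<epsilon>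
  proof -
    obtain L C where LC: "\<And>k n. \<bar>F k n - L * real n\<bar> \<le> \<epsilon> / 2 * real n + C"
      using assms[OF half_gt_zero[OF eps]] by blast
    \<comment> \<open>Beyond this threshold the constant \<open>C\<close> is absorbed by the other
      half of \<open>\<epsilon> * real n\<close>.\<close>
    obtain N0 :: nat where N0: "real N0 > 2 * \<bar>C\<bar> / \<epsilon>" using reals_Archimedean2 by blast
    have "\<bar>F k n / real n - L\<bar> < \<epsilon>" if n: "n \<ge> Suc N0" for k n
    proof -
      have "2 * \<bar>C\<bar> / \<epsilon> < real n" using N0 n by linarith
      then have "C < \<epsilon> / 2 * real n" using \<open>\<epsilon> > 0\<close> by (simp add: field_simps)
      then have "\<bar>F k n - L * real n\<bar> < \<epsilon> * real n" using LC[of k n] by linarith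
      moreover have "\<bar>F k n / real n - L\<bar> = \<bar>F k n - L * real n\<bar> / real n"
      proof -
        have "F k n / real n - L = (F k n - L * real n) / real n"
          using n by (simp add: field_simps)
        then show ?thesis by simp
      qed
      ultimately show ?thesis using n by (simp add: field_simps)
    qed
    then show ?thesis by blast
  qed
  have "Cauchy (\<lambda>n. F 0 n / real n)"
  proof (rule metric_CauchyI)
    fix e :: real assume "e > 0"
    then obtain L N where LN: "\<And>n. n \<ge> N \<Longrightarrow> \<bar>F 0 n / real n - L\<bar> < e / 2"
      using ex[of "e / 2"] by auto
    have "dist (F 0 m / real m) (F 0 n / real n) < e" if "m \<ge> N" "n \<ge> N" for m n
      using LN[OF that(1)] LN[OF that(2)] unfolding dist_real_def by linarith
    then show "\<exists>M. \<forall>m\<ge>M. \<forall>n\<ge>M. dist (F 0 m / real m) (F 0 n / real n) < e" by blast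
  qed
  then obtain l where l: "(\<lambda>n. F 0 n / real n) \<longlonglongrightarrow> l"
    using real_Cauchy_convergent convergent_def by blast
  have "uniform_limit UNIV (\<lambda>n k. F k n / real n) (\<lambda>k. l) sequentially"
  proof (rule uniform_limitI)
    fix e :: real assume "e > 0"
    then obtain L N where LN: "\<And>k n. n \<ge> N \<Longrightarrow> \<bar>F k n / real n - L\<bar> < e / 3"
      using ex[of "e / 3"] by auto
    obtain N' where N': "\<And>n. n \<ge> N' \<Longrightarrow> \<bar>F 0 n / real n - l\<bar> < e / 3"
      using LIMSEQ_D[OF l, of "e / 3"] \<open>e > 0\<close> by auto
    have "dist (F k n / real n) l < e" if "n \<ge> max N N'" for k n
      using LN[of n k] LN[of n 0] N'[of n] that unfolding dist_real_def by (simp; linarith)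
    then show "\<forall>\<^sub>F n in sequentially. \<forall>k\<in>UNIV. dist (F k n / real n) l < e"
      unfolding eventually_sequentially by blast
  qed
  then show ?thesis by blast
qed

definition good_block :: "word \<Rightarrow> real \<Rightarrow> real \<Rightarrow> word \<Rightarrow> bool" where
  "good_block u \<epsilon> L B \<longleftrightarrow>
     \<bar>real (occ u B) - L * real (length B)\<bar> + real (length u) + 1 \<le> \<epsilon> * real (length B)"

text \<open>The summand \<open>length u + 1\<close> in \<^const>\<open>good_block\<close> pays for the occurrences
  across the boundary between two consecutive blocks.\<close>

lemma occ_concat_good_blocks:
  assumes "\<forall>B\<in>set Bs. good_block u \<epsilon> L B"
  shows "\<bar>real (occ u (concat Bs)) - L * real (length (concat Bs))\<bar>
           \<le> \<epsilon> * real (length (concat Bs)) + 1"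
  using assms
proof (induction Bs)
  case Nil
  show ?case using occ_le[of u "[]"] by simp
next
  case (Cons B Bs)
  then have "\<bar>real (occ u B) - L * real (length B)\<bar> + real (length u) + 1 \<le> \<epsilon> * real (length B)"
    "\<bar>real (occ u (concat Bs)) - L * real (length (concat Bs))\<bar>
       \<le> \<epsilon> * real (length (concat Bs)) + 1"
    by (simp_all add: good_block_def)
  then show ?case using occ_append_abs[of u B "concat Bs"]
    unfolding concat.simps length_append of_nat_add distrib_left by linarith
qed

lemma uniform_word_frequencies_blocks:
  assumes "\<And>u \<epsilon>. \<epsilon> > 0 \<Longrightarrow> \<exists>L C. \<forall>k n. \<exists>t1 Bs t2.
     map w [k..<k + n] = t1 @ concat Bs @ t2 \<and> length t1 \<le> C \<and> length t2 \<le> C \<and>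
     (\<forall>B\<in>set Bs. good_block u \<epsilon> L B)"
  shows "uniform_word_frequencies w"
  unfolding uniform_word_frequencies_def
proof (intro allI uniform_limit_ratio)
  fix u :: word and \<epsilon> :: real
  assume "\<epsilon> > 0"
  then obtain L C where LC: "\<And>k n. \<exists>t1 Bs t2.
     map w [k..<k + n] = t1 @ concat Bs @ t2 \<and> length t1 \<le> C \<and> length t2 \<le> C \<and>
     (\<forall>B\<in>set Bs. good_block u \<epsilon> L B)"
    using assms[of \<epsilon> u] by blast
  \<comment> \<open>Each end contributes at most \<open>C + 1\<close> occurrences and
    \<open>\<bar>L\<bar> * C\<close> to the expected count, each of the two junctions costs
    \<open>length u + 1\<close>, and the concatenation of blocks leaves 1.\<close>
  define D where "D = 2 * \<bar>L\<bar> * real C + 2 * real C + 2 * real (length u) + 5"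
  have "\<bar>real (occ u (map w [k..<k + n])) - L * real n\<bar> \<le> \<epsilon> * real n + D" for k n
  proof -
    obtain t1 Bs t2 where t: "map w [k..<k + n] = t1 @ concat Bs @ t2"
      and l: "length t1 \<le> C" "length t2 \<le> C" and B: "\<forall>B\<in>set Bs. good_block u \<epsilon> L B"
      using LC by blast
    define c where "c = length (concat Bs)"
    have "length (map w [k..<k + n]) = length t1 + c + length t2"
      unfolding t c_def by simp
    then have n: "real n = real (length t1) + real c + real (length t2)" by simp
    have a: "\<bar>real (occ u (concat Bs)) - L * real c\<bar> \<le> \<epsilon> * real c + 1"
      unfolding c_def by (rule occ_concat_good_blocks[OF B])
    have "\<bar>L * real (length t1)\<bar> \<le> \<bar>L\<bar> * real C" "\<bar>L * real (length t2)\<bar> \<le> \<bar>L\<bar> * real C"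
      using l by (auto simp: abs_mult intro!: mult_left_mono)
    moreover have "\<epsilon> * real c \<le> \<epsilon> * real n" using \<open>\<epsilon> > 0\<close> n by simp
    moreover have "L * real n = L * real (length t1) + L * real c + L * real (length t2)"
      unfolding n by (simp add: algebra_simps)
    ultimately show ?thesis
      using a occ_append_abs[of u t1 "concat Bs @ t2"] occ_append_abs[of u "concat Bs" t2]
        occ_le[of u t1] occ_le[of u t2] l
      unfolding t D_def by linarith
  qed
  then show "\<exists>L C. \<forall>k n. \<bar>real (occ u (map w [k..<k + n])) - L * real n\<bar> \<le> \<epsilon> * real n + C"
    by blast
qed

section \<open>Factors of concatenations\<close>

text \<open>The cut between \<open>A\<close> and \<open>t\<close> falls inside at most one block;
  \<open>t1\<close> is the part of that block to the right of the cut.\<close>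

lemma suffix_concat_blocks:
  assumes "concat (map g V) = A @ t" "\<forall>b. length (g b) \<le> C"
  shows "\<exists>V1 V2 t1. V = V1 @ V2 \<and> t = t1 @ concat (map g V2) \<and> length t1 \<le> C"
  using assms(1)
proof (induction V arbitrary: A)
  case Nil
  then show ?case by auto
next
  case (Cons b V)
  then have "g b @ concat (map g V) = A @ t" by simp
  then consider us where "A = g b @ us" "concat (map g V) = us @ t"
    | us where "g b = A @ us" "t = us @ concat (map g V)"
    by (auto simp: append_eq_append_conv2)
  then show ?case
  proof cases
    case 1
    then obtain V1 V2 t1 where "V = V1 @ V2" "t = t1 @ concat (map g V2)" "length t1 \<le> C"
      using Cons.IH by blast
    then have "b # V = (b # V1) @ V2 \<and> t = t1 @ concat (map g V2) \<and> length t1 \<le> C" by simp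
    then show ?thesis by (intro exI)
  next
    case 2
    then have "length us \<le> C" using assms(2)[rule_format, of b] by simp
    then have "b # V = [b] @ V \<and> t = us @ concat (map g V) \<and> length us \<le> C" using 2 by simp
    then show ?thesis by (intro exI)
  qed
qed

text \<open>Mirror image of the previous cut: \<open>t2\<close> is the initial part of the block
  that is cut at the right end.\<close>

lemma prefix_concat_blocks:
  assumes "concat (map g V) = t @ A" "\<forall>b. length (g b) \<le> C"
  shows "\<exists>V1 V2 t2. V = V1 @ V2 \<and> t = concat (map g V1) @ t2 \<and> length t2 \<le> C"
  using assms(1)
proof (induction V arbitrary: t)
  case Nil
  then show ?case by auto
next
  case (Cons b V)
  then have "g b @ concat (map g V) = t @ A" by simp
  then consider us where "t = g b @ us" "concat (map g V) = us @ A"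
    | us where "g b = t @ us"
    by (auto simp: append_eq_append_conv2)
  then show ?case
  proof cases
    case 1
    then obtain V1 V2 t2 where "V = V1 @ V2" "us = concat (map g V1) @ t2" "length t2 \<le> C"
      using Cons.IH by blast
    then have "b # V = (b # V1) @ V2 \<and> t = concat (map g (b # V1)) @ t2 \<and> length t2 \<le> C"
      using 1 by simp
    then show ?thesis by (intro exI)
  next
    case 2
    then have "length t \<le> C" using assms(2)[rule_format, of b] by simp
    then have "b # V = [] @ (b # V) \<and> t = concat (map g []) @ t \<and> length t \<le> C" by simp
    then show ?thesis by (intro exI)
  qed
qed

lemma factor_concat_blocks:
  assumes "concat (map g V) = A @ t @ B" "\<forall>b. length (g b) \<le> C"
  shows "\<exists>V1 V' V2 t1 t2. V = V1 @ V' @ V2 \<and> t = t1 @ concat (map g V') @ t2 \<and>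
           length t1 \<le> C \<and> length t2 \<le> C"
proof -
  obtain V1 V2 t1 where 1: "V = V1 @ V2" "t @ B = t1 @ concat (map g V2)" "length t1 \<le> C"
    using suffix_concat_blocks[OF assms] by blast
  from 1(2) consider us where "t1 = t @ us" | us where "t = t1 @ us" "concat (map g V2) = us @ B"
    by (auto simp: append_eq_append_conv2)
  then show ?thesis
  proof cases
    case 1
    \<comment> \<open>Here \<open>t\<close> ends within the block in which it starts, so there is no
      full block to extract.\<close>
    then have "length t \<le> C" using \<open>length t1 \<le> C\<close> by simp
    show ?thesis
      by (rule exI[of _ V], rule exI[of _ "[]"], rule exI[of _ "[]"],
          rule exI[of _ t], rule exI[of _ "[]"]) (simp add: \<open>length t \<le> C\<close>)
  next
    case 2
    obtain V3 V4 t2 where "V2 = V3 @ V4" "us = concat (map g V3) @ t2" "length t2 \<le> C"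
      using prefix_concat_blocks[OF 2(2) assms(2)] by blast
    then have "V = V1 @ V3 @ V4 \<and> t = t1 @ concat (map g V3) @ t2 \<and>
        length t1 \<le> C \<and> length t2 \<le> C"
      using 1 2 by simp
    then show ?thesis by (intro exI)
  qed
qed

section \<open>Products of substitutions\<close>

lemma subst_append:
  assumes "s \<in> {c1, c2}"
  shows "s (u @ v) = s u @ s v"
  using assms by (auto simp: c1_def c2_def endo_append)

context
  fixes \<sigma> :: "nat \<Rightarrow> subst"
  assumes \<sigma>: "\<sigma> n \<in> {c1, c2}"
begin

lemma subst_prod_append: "subst_prod \<sigma> n (u @ v) = subst_prod \<sigma> n u @ subst_prod \<sigma> n v"
  by (induction n arbitrary: u v) (simp_all add: subst_append[OF \<sigma>])

lemma subst_prod_Nil: "subst_prod \<sigma> n [] = []"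
  using subst_prod_append[of n "[]" "[]"] by simp

lemma subst_prod_concat: "subst_prod \<sigma> n V = concat (map (\<lambda>b. subst_prod \<sigma> n [b]) V)"
proof (induction V)
  case Nil
  show ?case by (simp add: subst_prod_Nil)
next
  case (Cons b V)
  then show ?case using subst_prod_append[of n "[b]" V] by simp
qed

lemma subst_prod_add:
  "subst_prod \<sigma> (n + m) = subst_prod \<sigma> n \<circ> subst_prod (\<lambda>i. \<sigma> (n + i)) m"
  by (induction m) (simp_all add: o_assoc)

text \<open>The newest factor \<open>\<sigma> n\<close> is innermost and acts first on
  \<open>b\<close>, so weights at time \<open>Suc n\<close> are sums of weights at time
  \<open>n\<close>.\<close>

lemma subst_prod_weights:
  "(\<Sum>c\<leftarrow>subst_prod \<sigma> (Suc n) [b]. h c) = (\<Sum>c\<leftarrow>\<sigma> n [b]. \<Sum>d\<leftarrow>subst_prod \<sigma> n [c]. h d)"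
proof -
  have "(\<Sum>c\<leftarrow>subst_prod \<sigma> n V. h c) = (\<Sum>c\<leftarrow>V. \<Sum>d\<leftarrow>subst_prod \<sigma> n [c]. h d)" for V
    by (subst subst_prod_concat) (induction V, simp_all)
  from this[of "\<sigma> n [b]"] show ?thesis by simp
qed

end

section \<open>Contraction\<close>

text \<open>\<open>F n b\<close> is the weight of the image of \<open>b\<close> under the product of the first \<open>n\<close>
  substitutions, for a weight that is additive on words.\<close>

definition adic_weights :: "(nat \<Rightarrow> subst) \<Rightarrow> (nat \<Rightarrow> letter \<Rightarrow> real) \<Rightarrow> bool" where
  "adic_weights \<tau> F \<longleftrightarrow> (\<forall>n b. F (Suc n) b = (\<Sum>c\<leftarrow>\<tau> n [b]. F n c))"

lemma adic_weightsI:
  assumes "\<And>n. \<tau> n \<in> {c1, c2}"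
  shows "adic_weights \<tau> (\<lambda>n b. \<Sum>c\<leftarrow>subst_prod \<tau> n [b]. h c)"
  unfolding adic_weights_def using subst_prod_weights[of \<tau>, OF assms] by blast

lemma adic_weights_step:
  assumes "adic_weights \<tau> F" "\<tau> n \<in> {c1, c2}"
  shows "\<tau> n = c1 \<and> F (Suc n) 1 = F n 1 \<and> F (Suc n) 2 = F n 1 + F n 3 \<and> F (Suc n) 3 = F n 2 \<or>
         \<tau> n = c2 \<and> F (Suc n) 1 = F n 2 \<and> F (Suc n) 2 = F n 1 + F n 3 \<and> F (Suc n) 3 = F n 3"
  using assms by (auto simp: adic_weights_def c1_letter c2_letter)

lemma c1_neq_c2: "c1 \<noteq> c2"
proof
  assume "c1 = c2"
  then have "c1 [1] = c2 [1]" by simp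
  then show False by (simp add: c1_letter c2_letter)
qed

definition balanced_lengths :: "(letter \<Rightarrow> real) \<Rightarrow> bool" where
  "balanced_lengths l \<longleftrightarrow> 0 < l 1 \<and> 0 < l 3 \<and> l 1 \<le> l 2 \<and> l 3 \<le> l 2 \<and> l 2 \<le> l 1 + l 3"

text \<open>The ratios \<open>h b / l b\<close> are confined to an interval. Multiplied out, the
  condition is linear and passes to sums over letters.\<close>

definition slopes_in :: "(letter \<Rightarrow> real) \<Rightarrow> (letter \<Rightarrow> real) \<Rightarrow> real \<Rightarrow> real \<Rightarrow> bool" where
  "slopes_in l h \<alpha> \<beta> \<longleftrightarrow> (\<forall>b. \<alpha> * l b \<le> h b \<and> h b \<le> \<beta> * l b)"

section \<open>Balance and growth of the lengths\<close>

context
  fixes \<tau> :: "nat \<Rightarrow> subst" and l :: "nat \<Rightarrow> letter \<Rightarrow> real"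
  assumes \<tau>: "\<tau> n \<in> {c1, c2}"
    and l: "adic_weights \<tau> l"
    and l0: "balanced_lengths (l 0)"
begin

text \<open>The bounds exchange roles: the upper bound on \<open>l n 2\<close> becomes a lower bound
  on \<open>l (Suc n) 2\<close>, and a lower bound becomes the upper one.\<close>

lemma balanced_lengths_all: "balanced_lengths (l n)"
proof (induction n)
  case 0
  show ?case by (fact l0)
next
  case (Suc n)
  then show ?case using adic_weights_step[OF l \<tau>, of n] unfolding balanced_lengths_def by auto
qed

lemma length_pos: "0 < l n b"
  using balanced_lengths_all[of n] exhaust_3[of b] unfolding balanced_lengths_def by auto

text \<open>From lengths \<open>(x, y, z)\<close>, \<open>c1\<close> followed by \<open>c2\<close>
  gives \<open>(x + z, x + y, y)\<close>, and the opposite order gives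
  \<open>(y, y + z, x + z)\<close>. By balance all entries lie between \<open>y\<close> and
  \<open>2 * y\<close>.\<close>

lemma lengths_after_switch:
  assumes "\<tau> n \<noteq> \<tau> (Suc n)"
  shows "l n 2 \<le> l (Suc (Suc n)) b \<and> l (Suc (Suc n)) b \<le> 2 * l n 2"
  using adic_weights_step[OF l \<tau>, of n] adic_weights_step[OF l \<tau>, of "Suc n"]
    balanced_lengths_all[of n] assms exhaust_3[of b]
  unfolding balanced_lengths_def by auto

lemma lengths_mono:
  assumes "\<And>b. K \<le> l n b"
  shows "K \<le> l (n + m) b"
proof (induction m arbitrary: b)
  case 0
  show ?case using assms by simp
next
  case (Suc m)
  have "K \<le> l (n + m) 1 + l (n + m) 3"
    using Suc[of 1] length_pos[of "n + m" 3] by linarith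
  then show ?case
    using adic_weights_step[OF l \<tau>, of "n + m"] Suc exhaust_3[of b] by auto
qed

lemma lengths_double:
  assumes "\<And>b. l n b \<le> K"
  shows "l (Suc n) b \<le> 2 * K"
  using adic_weights_step[OF l \<tau>, of n] assms[of 1] assms[of 2] assms[of 3]
    length_pos[of n 1] exhaust_3[of b] by auto

text \<open>Every switch doubles the lower bound on the three lengths, and no step decreases
  it.\<close>

lemma lengths_unbounded:
  assumes sw: "\<And>n. \<exists>m\<ge>n. \<tau> m \<noteq> \<tau> (Suc m)"
  shows "\<exists>n. \<forall>b. K \<le> l n b"
proof -
  define \<mu> where "\<mu> = Min (range (l 0))"
  have \<mu>: "\<mu> \<le> l 0 b" for b unfolding \<mu>_def by (rule Min_le) auto
  have "\<mu> \<in> range (l 0)" unfolding \<mu>_def by (rule Min_in) auto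
  then have "\<mu> > 0" using length_pos by auto
  have "\<exists>n. \<forall>b. 2 ^ i * \<mu> \<le> l n b" for i
  proof (induction i)
    case 0
    then show ?case using \<mu> by auto
  next
    case (Suc i)
    then obtain n where n: "\<And>b. 2 ^ i * \<mu> \<le> l n b" by blast
    \<comment> \<open>Taking \<open>m\<close> strictly beyond \<open>n\<close> makes
      \<open>l m 2\<close> a sum of two lengths that already satisfy the bound; two steps later all
      lengths are at least \<open>l m 2\<close>.\<close>
    obtain m where m: "m \<ge> Suc n" "\<tau> m \<noteq> \<tau> (Suc m)" using sw by blast
    then obtain j where j: "m = Suc (n + j)" using less_iff_Suc_add Suc_le_eq by metis
    have "2 ^ Suc i * \<mu> \<le> l (n + j) 1 + l (n + j) 3"
      using lengths_mono[OF n, of j 1] lengths_mono[OF n, of j 3] by simp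
    also have "\<dots> = l m 2" unfolding j using adic_weights_step[OF l \<tau>, of "n + j"] by auto
    finally have "2 ^ Suc i * \<mu> \<le> l (Suc (Suc m)) b" for b
      using lengths_after_switch[OF m(2), of b] by linarith
    then show ?case by blast
  qed
  moreover obtain i where "K / \<mu> < 2 ^ i" using real_arch_pow[of 2 "K / \<mu>"] by auto
  then have "K \<le> 2 ^ i * \<mu>" using \<open>\<mu> > 0\<close> by (simp add: field_simps)
  ultimately show ?thesis by (meson order_trans)
qed

text \<open>Combinatorially: the letter \<open>v\<close> occurs in the images of all three letters under
  \<open>\<tau>\<^sub>n \<cdots> \<tau>\<^sub>n\<^sub>+\<^sub>3\<close>. The witness in the proof was found by going through the 16 products.\<close>

lemma common_letter:
  "\<exists>v. \<forall>F. adic_weights \<tau> F \<longrightarrow> (\<forall>b. 0 \<le> F n b) \<longrightarrow> (\<forall>b. F n v \<le> F (n + 4) b)"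
proof -
  define d where "d i \<longleftrightarrow> \<tau> (n + i) = c1" for i
  define v :: letter where
    "v = (if d 1 \<noteq> d 0 \<and> d 2 = d 1 \<and> d 3 = d 1 then 2 else if d 0 then 1 else 3)"
  have "F n v \<le> F (n + 4) b" if F: "adic_weights \<tau> F" and pos: "\<forall>b. 0 \<le> F n b" for F b
  proof -
    define x y z where "x i = F (n + i) 1" "y i = F (n + i) 2" "z i = F (n + i) 3" for i
    have step: "x (Suc i) = (if d i then x i else y i)" "y (Suc i) = x i + z i"
      "z (Suc i) = (if d i then y i else z i)" for i
      using adic_weights_step[OF F \<tau>, of "n + i"] c1_neq_c2 by (auto simp: x_y_z_def d_def)
    have nn: "0 \<le> x 0" "0 \<le> y 0" "0 \<le> z 0" using pos by (auto simp: x_y_z_def)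
    have v: "F n v = (if d 1 \<noteq> d 0 \<and> d 2 = d 1 \<and> d 3 = d 1 then y 0 else if d 0 then x 0 else z 0)"
      by (simp add: v_def x_y_z_def)
    have s4: "x 4 = (if d 3 then x 3 else y 3)" "y 4 = x 3 + z 3" "z 4 = (if d 3 then y 3 else z 3)"
      "x 3 = (if d 2 then x 2 else y 2)" "y 3 = x 2 + z 2" "z 3 = (if d 2 then y 2 else z 2)"
      "x 2 = (if d 1 then x 1 else y 1)" "y 2 = x 1 + z 1" "z 2 = (if d 1 then y 1 else z 1)"
      "x 1 = (if d 0 then x 0 else y 0)" "y 1 = x 0 + z 0" "z 1 = (if d 0 then y 0 else z 0)"
      using step[of 3] step[of 2] step[of 1] step[of 0] by (simp_all add: numeral_eq_Suc)
    \<comment> \<open>In each of the 16 cases the right-hand sides expand to sums of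
      \<open>x 0\<close>, \<open>y 0\<close>, \<open>z 0\<close> that contain the chosen one. The
      literal 1 is kept so that the equations \<open>s4\<close> apply.\<close>
    have "F n v \<le> x 4 \<and> F n v \<le> y 4 \<and> F n v \<le> z 4"
      unfolding v using nn
      by (cases "d 0"; cases "d 1"; cases "d 2"; cases "d 3") (simp_all add: s4 del: One_nat_def)
    then show ?thesis using exhaust_3[of b] unfolding x_y_z_def by (elim disjE) simp_all
  qed
  then show ?thesis by (intro exI[of _ v] allI impI)
qed

section \<open>Contraction of the interval of slopes\<close>

context
  fixes h :: "nat \<Rightarrow> letter \<Rightarrow> real"
  assumes h: "adic_weights \<tau> h"
begin

lemma slopes_in_step:
  assumes "slopes_in (l n) (h n) \<alpha> \<beta>"
  shows "slopes_in (l (Suc n)) (h (Suc n)) \<alpha> \<beta>"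
  unfolding slopes_in_def
proof
  fix b
  have *: "\<alpha> * l n c \<le> h n c" "h n c \<le> \<beta> * l n c" for c using assms by (auto simp: slopes_in_def)
  show "\<alpha> * l (Suc n) b \<le> h (Suc n) b \<and> h (Suc n) b \<le> \<beta> * l (Suc n) b"
    using adic_weights_step[OF l \<tau>, of n] adic_weights_step[OF h \<tau>, of n] c1_neq_c2
      *[of 1] *[of 2] *[of 3] exhaust_3[of b]
    by (auto simp: distrib_left)
qed

lemma slopes_in_add:
  assumes "slopes_in (l n) (h n) \<alpha> \<beta>"
  shows "slopes_in (l (n + m)) (h (n + m)) \<alpha> \<beta>"
  using assms slopes_in_step by (induction m) auto

text \<open>Two steps after the switch all lengths lie between \<open>E\<close> and
  \<open>2 * E\<close>, and four more steps give at most \<open>32 * E\<close>. The distances of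
  \<open>h\<close> to the two bounding lines are nonnegative additive weights; the common letter
  passes its share of both to every letter, and these shares add up to at least
  \<open>D * E\<close>. So the interval loses at least \<open>D / 32\<close>.\<close>

lemma slopes_contract:
  assumes "\<tau> n \<noteq> \<tau> (Suc n)" "slopes_in (l n) (h n) \<alpha> (\<alpha> + D)" "0 \<le> D"
  shows "\<exists>\<alpha>'. slopes_in (l (n + 6)) (h (n + 6)) \<alpha>' (\<alpha>' + 31 / 32 * D)"
proof -
  define m where "m = n + 2"
  define E where "E = l n 2"
  have E: "E > 0" unfolding E_def by (rule length_pos)
  have lm: "E \<le> l m b" "l m b \<le> 2 * E" for b
    using lengths_after_switch[OF assms(1), of b] by (auto simp: m_def E_def)
  have 4: "m + 4 = Suc (Suc (Suc (Suc m)))" by simp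
  have lm4: "l (m + 4) b \<le> 32 * E" for b
  proof -
    have "l (m + 4) b \<le> 2 * (2 * (2 * (2 * (2 * E))))"
      unfolding 4 by (intro lengths_double lm)
    then show ?thesis by simp
  qed
  \<comment> \<open>Distance to the lower and to the upper line; by linearity both satisfy the
    weight recursion.\<close>
  define A where "A k b = h k b - \<alpha> * l k b" for k b
  define B where "B k b = (\<alpha> + D) * l k b - h k b" for k b
  have sum_diff: "(\<Sum>c\<leftarrow>V. x * f c - y * g c) = x * (\<Sum>c\<leftarrow>V. f c) - y * (\<Sum>c\<leftarrow>V. g c)"
    for V :: word and f g :: "letter \<Rightarrow> real" and x y
    by (induction V) (simp_all add: algebra_simps)
  have A: "adic_weights \<tau> A"
    using l h sum_diff[of 1 _ \<alpha>] by (simp add: adic_weights_def A_def)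
  have B: "adic_weights \<tau> B"
    using l h sum_diff[of "\<alpha> + D" _ 1] by (simp add: adic_weights_def B_def)
  have "slopes_in (l m) (h m) \<alpha> (\<alpha> + D)"
    unfolding m_def by (rule slopes_in_add) (rule assms)
  then have "\<forall>b. 0 \<le> A m b" "\<forall>b. 0 \<le> B m b" by (auto simp: slopes_in_def A_def B_def)
  then obtain v where v: "\<And>b. A m v \<le> A (m + 4) b" "\<And>b. B m v \<le> B (m + 4) b"
    and Av: "0 \<le> A m v" and Bv: "0 \<le> B m v"
    using common_letter[of m] A B by blast
  \<comment> \<open>The lower slope rises by the gain at \<open>v\<close>, spread over the largest
    possible length \<open>32 * E\<close>.\<close>
  define \<alpha>' where "\<alpha>' = \<alpha> + A m v / (32 * E)"
  have bound: "x / (32 * E) * l (m + 4) b \<le> x" if "0 \<le> x" for x b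
  proof -
    have "x / (32 * E) * l (m + 4) b \<le> x / (32 * E) * (32 * E)"
      using that E by (intro mult_left_mono lm4) simp
    then show ?thesis using E by simp
  qed
  have "D * E \<le> D * l m v" using assms(3) by (intro mult_left_mono lm)
  also have "\<dots> = A m v + B m v" by (simp add: A_def B_def algebra_simps)
  finally have "D \<le> (A m v + B m v) / E" using E by (simp add: field_simps)
  then have D: "\<alpha> + D - B m v / (32 * E) \<le> \<alpha>' + 31 / 32 * D"
    unfolding \<alpha>'_def by (simp add: add_divide_distrib)
  have "slopes_in (l (m + 4)) (h (m + 4)) \<alpha>' (\<alpha>' + 31 / 32 * D)"
    unfolding slopes_in_def
  proof (intro allI conjI)
    fix b
    have "\<alpha>' * l (m + 4) b = \<alpha> * l (m + 4) b + A m v / (32 * E) * l (m + 4) b"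
      unfolding \<alpha>'_def by (rule distrib_right)
    also have "\<dots> \<le> h (m + 4) b"
      using bound[OF Av, of b] v(1)[of b] unfolding A_def by linarith
    finally show "\<alpha>' * l (m + 4) b \<le> h (m + 4) b" .
    have "h (m + 4) b \<le> (\<alpha> + D) * l (m + 4) b - B m v / (32 * E) * l (m + 4) b"
      using bound[OF Bv, of b] v(2)[of b] unfolding B_def by linarith
    also have "\<dots> = (\<alpha> + D - B m v / (32 * E)) * l (m + 4) b" by (simp add: left_diff_distrib)
    also have "\<dots> \<le> (\<alpha>' + 31 / 32 * D) * l (m + 4) b"
      using length_pos[of "m + 4" b] by (intro mult_right_mono D) simp
    finally show "h (m + 4) b \<le> (\<alpha>' + 31 / 32 * D) * l (m + 4) b" .
  qed
  moreover have "m + 4 = n + 6" by (simp add: m_def)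
  ultimately show ?thesis by metis
qed

text \<open>The width shrinks by a fixed factor after each switch and can be kept while waiting for
  the next one.\<close>

lemma slopes_converge:
  assumes sw: "\<And>n. \<exists>m\<ge>n. \<tau> m \<noteq> \<tau> (Suc m)" and "\<epsilon> > 0"
  shows "\<exists>n \<alpha>. slopes_in (l n) (h n) \<alpha> (\<alpha> + \<epsilon>)"
proof -
  define M where "M = Max (range (\<lambda>b. \<bar>h 0 b\<bar> / l 0 b))"
  have ratio: "\<bar>h 0 b\<bar> / l 0 b \<le> M" for b unfolding M_def by (rule Max_ge) auto
  have M: "\<bar>h 0 b\<bar> \<le> M * l 0 b" for b using ratio[of b] length_pos[of 0 b] by (simp add: field_simps)
  have "0 \<le> \<bar>h 0 1\<bar> / l 0 1" using length_pos[of 0 1] by simp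
  also have "\<dots> \<le> M" by (rule ratio)
  finally have "0 \<le> M" .
  \<comment> \<open>All initial slopes lie in \<open>[-M, M]\<close>, an interval of width
    \<open>2 * M\<close>.\<close>
  define q where "q i = (31 / 32) ^ i * (2 * M)" for i :: nat
  have "\<exists>n \<alpha>. slopes_in (l n) (h n) \<alpha> (\<alpha> + q i)" for i
  proof (induction i)
    case 0
    have "slopes_in (l 0) (h 0) (- M) (- M + q 0)"
      unfolding slopes_in_def q_def using M by (auto simp: abs_le_iff minus_le_iff)
    then show ?case by blast
  next
    case (Suc i)
    then obtain n \<alpha> where "slopes_in (l n) (h n) \<alpha> (\<alpha> + q i)" by blast
    moreover obtain m where m: "m \<ge> n" "\<tau> m \<noteq> \<tau> (Suc m)" using sw by blast
    ultimately have "slopes_in (l m) (h m) \<alpha> (\<alpha> + q i)"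
      using slopes_in_add[of n \<alpha> _ "m - n"] by simp
    moreover have "0 \<le> q i" using \<open>0 \<le> M\<close> by (simp add: q_def)
    ultimately obtain \<alpha>' where "slopes_in (l (m + 6)) (h (m + 6)) \<alpha>' (\<alpha>' + 31 / 32 * q i)"
      using slopes_contract[OF m(2)] by blast
    moreover have "31 / 32 * q i = q (Suc i)" by (simp add: q_def)
    ultimately show ?case by auto
  qed
  moreover obtain i where "q i < \<epsilon>"
  proof -
    \<comment> \<open>Adding 1 keeps the denominator positive when \<open>M = 0\<close>.\<close>
    obtain i where "(31 / 32 :: real) ^ i < \<epsilon> / (2 * M + 1)"
      using real_arch_pow_inv[of "\<epsilon> / (2 * M + 1)" "31 / 32"] \<open>\<epsilon> > 0\<close> \<open>0 \<le> M\<close> by auto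
    then have "(31 / 32) ^ i * (2 * M + 1) < \<epsilon>" using \<open>0 \<le> M\<close> by (simp add: field_simps)
    moreover have "q i \<le> (31 / 32) ^ i * (2 * M + 1)" unfolding q_def by (intro mult_left_mono) auto
    ultimately show ?thesis using that[of i] by linarith
  qed
  ultimately obtain n \<alpha> where s: "slopes_in (l n) (h n) \<alpha> (\<alpha> + q i)" by blast
  have "(\<alpha> + q i) * l n b \<le> (\<alpha> + \<epsilon>) * l n b" for b
    using \<open>q i < \<epsilon>\<close> length_pos[of n b] by (intro mult_right_mono) auto
  then have "slopes_in (l n) (h n) \<alpha> (\<alpha> + \<epsilon>)"
    using s unfolding slopes_in_def by (meson order_trans)
  then show ?thesis by blast
qed

end

end

section \<open>Blocks for directive sequences\<close>

context
  fixes \<sigma> :: "nat \<Rightarrow> subst"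
  assumes \<sigma>: "\<sigma> n \<in> {c1, c2}"
begin

lemma length_subst_prod_letters:
  "real (length (subst_prod \<sigma> n V)) = (\<Sum>c\<leftarrow>V. real (length (subst_prod \<sigma> n [c])))"
  by (subst subst_prod_concat[of \<sigma>, OF \<sigma>]) (induction V, simp_all)

lemma balanced_lengths_subst_prod:
  "balanced_lengths (\<lambda>b. real (length (subst_prod \<sigma> n [b])))"
proof -
  let ?l = "\<lambda>n b. \<Sum>c\<leftarrow>subst_prod \<sigma> n [b]. 1 :: real"
  have "balanced_lengths (?l 0)" by (simp add: balanced_lengths_def)
  from balanced_lengths_all[of \<sigma> ?l, OF \<sigma> adic_weightsI[of \<sigma>, OF \<sigma>] this]
  show ?thesis by (simp add: sum_list_triv)
qed

lemma subst_prod_nonempty: "1 \<le> length (subst_prod \<sigma> n [b])"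
  using balanced_lengths_subst_prod[of n] exhaust_3[of b]
  by (auto simp: balanced_lengths_def Suc_le_eq)

lemma length_subst_prod_ge: "length V \<le> length (subst_prod \<sigma> n V)"
proof -
  have "length V \<le> length (concat (map (\<lambda>b. subst_prod \<sigma> n [b]) V))"
  proof (induction V)
    case (Cons b V)
    then show ?case using subst_prod_nonempty[of n b] by simp
  qed simp
  then show ?thesis by (subst subst_prod_concat[of \<sigma>, OF \<sigma>])
qed

lemma length_subst_prod_le:
  assumes "\<And>b. length (subst_prod \<sigma> n [b]) \<le> C"
  shows "length (subst_prod \<sigma> n V) \<le> C * length V"
proof -
  have "length (concat (map (\<lambda>b. subst_prod \<sigma> n [b]) V)) \<le> C * length V"
    using assms by (induction V) (simp_all add: add_mono)
  then show ?thesis by (subst subst_prod_concat[of \<sigma>, OF \<sigma>])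
qed

lemma subst_prod_concat_replicate:
  "subst_prod \<sigma> n (concat (replicate q X)) = concat (replicate q (subst_prod \<sigma> n X))"
  by (induction q)
    (simp_all add: subst_prod_append[of \<sigma>, OF \<sigma>] subst_prod_Nil[of \<sigma>, OF \<sigma>])

end

text \<open>Counting occurrences is additive only up to boundary effects. First \<open>n\<close> is
  chosen so large that these are small relative to the images of letters; then the contraction is
  applied to the occurrences inside these images, which do form an additive weight.\<close>

lemma good_blocks:
  assumes \<sigma>: "\<And>n. \<sigma> n \<in> {c1, c2}"
    and sw: "\<And>n. \<exists>m\<ge>n. \<sigma> m \<noteq> \<sigma> (Suc m)" and "\<epsilon> > 0"
  shows "\<exists>n L. \<forall>b. good_block u \<epsilon> L (subst_prod \<sigma> n [b])"
proof -
  define c where "c = real (length u) + 1"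
  have "balanced_lengths (\<lambda>b. \<Sum>c\<leftarrow>subst_prod \<sigma> 0 [b]. 1)" by (simp add: balanced_lengths_def)
  \<comment> \<open>With this length, a correction \<open>c\<close> per image costs at most
    \<open>\<epsilon> / 4\<close> of its length.\<close>
  from lengths_unbounded[of \<sigma>, OF \<sigma> adic_weightsI[of \<sigma>, OF \<sigma>] this sw, of "4 * c / \<epsilon>"]
  obtain n where n: "4 * c / \<epsilon> \<le> real (length (subst_prod \<sigma> n [b]))" for b
    by (auto simp: sum_list_triv)
  define s where "s = subst_prod \<sigma> n"
  \<comment> \<open>The recursion restarts at \<open>n\<close>, with the lengths and counts of the
    images under \<open>s\<close> as initial weights.\<close>
  define \<tau> where "\<tau> = (\<lambda>i. \<sigma> (n + i))"
  have \<tau>: "\<tau> i \<in> {c1, c2}" for i using \<sigma> by (simp add: \<tau>_def)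
  define l where "l m b = (\<Sum>c\<leftarrow>subst_prod \<tau> m [b]. real (length (s [c])))" for m b
  define h where "h m b = (\<Sum>c\<leftarrow>subst_prod \<tau> m [b]. real (occ u (s [c])))" for m b
  have l: "adic_weights \<tau> l" unfolding l_def by (rule adic_weightsI[OF \<tau>])
  have h: "adic_weights \<tau> h" unfolding h_def by (rule adic_weightsI[OF \<tau>])
  have l0: "balanced_lengths (l 0)"
    using balanced_lengths_subst_prod[of \<sigma>, OF \<sigma>, of n] by (simp add: l_def[abs_def] s_def)
  have "\<exists>m\<ge>k. \<tau> m \<noteq> \<tau> (Suc m)" for k
  proof -
    obtain m where "m \<ge> n + k" "\<sigma> m \<noteq> \<sigma> (Suc m)" using sw by blast
    then have "m - n \<ge> k \<and> \<tau> (m - n) \<noteq> \<tau> (Suc (m - n))" by (simp add: \<tau>_def)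
    then show ?thesis by blast
  qed
  from slopes_converge[of \<tau>, OF \<tau> l l0 h this, of "\<epsilon> / 4"] \<open>\<epsilon> > 0\<close>
  obtain m L where sl: "slopes_in (l m) (h m) L (L + \<epsilon> / 4)" by auto
  have "good_block u \<epsilon> L (subst_prod \<sigma> (n + m) [b])" for b
  proof -
    define V where "V = subst_prod \<tau> m [b]"
    define B where "B = subst_prod \<sigma> (n + m) [b]"
    have BV: "B = s V"
      unfolding B_def s_def V_def \<tau>_def subst_prod_add[of \<sigma>, OF \<sigma>, of n m] by simp
    have lB: "real (length B) = l m b"
      unfolding BV s_def l_def V_def by (rule length_subst_prod_letters[of \<sigma>, OF \<sigma>])
    have "B = concat (map (\<lambda>c. s [c]) V)"
      unfolding BV s_def by (rule subst_prod_concat[of \<sigma>, OF \<sigma>])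
    then have occB: "\<bar>real (occ u B) - h m b\<bar> \<le> c * real (length V) + 1"
      using occ_concat[of u "map (\<lambda>c. s [c]) V"] by (simp add: h_def V_def c_def o_def)
    have "1 \<le> length V"
      unfolding V_def by (rule subst_prod_nonempty[of \<tau>, OF \<tau>])
    have "real (length V) * (4 * c / \<epsilon>) \<le> (\<Sum>c\<leftarrow>V. real (length (s [c])))"
    proof (induction V)
      case (Cons a V)
      then show ?case using n[of a] by (simp only: s_def list.map sum_list.Cons length_Cons
            of_nat_Suc distrib_right mult_1_left add_mono)
    qed simp
    also have "\<dots> = real (length B)" by (simp add: lB l_def V_def)
    finally have "4 * (c * real (length V)) \<le> \<epsilon> * real (length B)"
      using \<open>\<epsilon> > 0\<close> by (simp add: field_simps)
    moreover have "1 \<le> c" "real (length u) = c - 1" by (simp_all add: c_def)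
    moreover have "c * 1 \<le> c * real (length V)"
      using \<open>1 \<le> length V\<close> by (intro mult_left_mono) (auto simp: c_def)
    moreover have "L * real (length B) \<le> h m b \<and> h m b \<le> L * real (length B) + \<epsilon> * real (length B) / 4"
      using sl unfolding slopes_in_def lB by (simp add: algebra_simps)
    \<comment> \<open>Four quarters of \<open>\<epsilon> * length B\<close> are spent: on the inner
      boundaries, on the additive 1, on \<open>length u + 1\<close>, and on the spread of the
      slopes.\<close>
    ultimately show ?thesis
      using occB unfolding good_block_def B_def[symmetric] by linarith
  qed
  then show ?thesis by blast
qed

text \<open>With \<open>L\<close> the exact frequency in the block, only the boundary term remains,
  and a long enough power of \<open>b\<close> outweighs it.\<close>

lemma periodic_good_block:
  assumes \<sigma>: "\<And>n. \<sigma> n \<in> {c1, c2}" and "\<epsilon> > 0"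
  shows "\<exists>r L. 0 < r \<and> good_block u \<epsilon> L (subst_prod \<sigma> n (replicate r b))"
proof -
  obtain r0 :: nat where r0: "(real (length u) + 1) / \<epsilon> < real r0"
    using reals_Archimedean2 by blast
  define r where "r = Suc r0"
  define B where "B = subst_prod \<sigma> n (replicate r b)"
  have "r \<le> length B"
    using length_subst_prod_ge[of \<sigma>, OF \<sigma>, of "replicate r b" n] by (simp add: B_def)
  then have "(real (length u) + 1) / \<epsilon> \<le> real (length B)" "real (length B) \<noteq> 0"
    using r0 by (auto simp: r_def)
  then have "good_block u \<epsilon> (real (occ u B) / real (length B)) B"
    using \<open>\<epsilon> > 0\<close> by (simp add: good_block_def field_simps)
  moreover have "0 < r" by (simp add: r_def)
  ultimately show ?thesis unfolding B_def by blast
qed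

text \<open>\<open>c1\<close> fixes 1, and the image of the last letter is \<open>[1]\<close>,
  \<open>[1, 3]\<close> or \<open>[2]\<close>, so only the last letter can differ from 1.\<close>

lemma constant_c1_image:
  assumes "\<And>n. \<tau> n = c1" "set (butlast V) \<subseteq> {1}"
  shows "set (butlast (subst_prod \<tau> j V)) \<subseteq> {1}"
  using assms(2)
proof (induction j arbitrary: V)
  case 0
  then show ?case by simp
next
  case (Suc j)
  have "set (butlast (c1 V)) \<subseteq> {1}"
  proof (cases V rule: rev_cases)
    case Nil
    then show ?thesis by (simp add: c1_def endo_def)
  next
    case (snoc X y)
    have "set X \<subseteq> {1}" using Suc.prems snoc by simp
    then have "c1 X = X" by (induction X) (auto simp: c1_def endo_def)
    then have "c1 V = X @ c1 [y]" using snoc by (simp add: c1_def endo_append)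
    moreover have "c1 [y] \<in> {[1], [1, 3], [2]}"
      using exhaust_3[of y] by (auto simp: c1_letter c2_letter)
    ultimately show ?thesis using \<open>set X \<subseteq> {1}\<close> by (auto simp: butlast_append)
  qed
  then show ?case using Suc.IH assms(1) by simp
qed

text \<open>Mirror image: \<open>c2\<close> fixes 3, and the images \<open>[2]\<close>,
  \<open>[1, 3]\<close>, \<open>[3]\<close> have nothing but 3 after their first letter.\<close>

lemma constant_c2_image:
  assumes "\<And>n. \<tau> n = c2" "set (tl V) \<subseteq> {3}"
  shows "set (tl (subst_prod \<tau> j V)) \<subseteq> {3}"
  using assms(2)
proof (induction j arbitrary: V)
  case 0
  then show ?case by simp
next
  case (Suc j)
  have "set (tl (c2 V)) \<subseteq> {3}"
  proof (cases V)
    case Nil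
    then show ?thesis by (simp add: c2_def endo_def)
  next
    case (Cons y X)
    have "set X \<subseteq> {3}" using Suc.prems Cons by simp
    then have "c2 X = X" by (induction X) (auto simp: c2_def endo_def)
    then have "c2 V = c2 [y] @ X" using Cons endo_append[of _ "[y]" X] by (simp add: c2_def)
    moreover have "c2 [y] \<in> {[2], [1, 3], [3]}"
      using exhaust_3[of y] by (auto simp: c1_letter c2_letter)
    ultimately show ?thesis using \<open>set X \<subseteq> {3}\<close> by auto
  qed
  then show ?case using Suc.IH assms(1) by simp
qed

text \<open>The exceptional letter sits at the end for \<open>c1\<close> and at the beginning for
  \<open>c2\<close>; \<open>b\<close> depends on neither \<open>j\<close> nor the factor.\<close>

lemma constant_image_factor:
  assumes "c \<in> {c1, c2}" "\<And>n. \<tau> n = c"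
  shows "\<exists>b. \<forall>j a V1 V' V2. subst_prod \<tau> j [a] = V1 @ V' @ V2 \<longrightarrow>
    (\<exists>P i Q. V' = P @ replicate i b @ Q \<and> length P \<le> 1 \<and> length Q \<le> 1)"
proof (cases "c = c1")
  case True
  have "\<exists>P i Q. V' = P @ replicate i 1 @ Q \<and> length P \<le> 1 \<and> length Q \<le> 1"
    if V: "subst_prod \<tau> j [a] = V1 @ V' @ V2" for j a V1 V' V2
  proof (cases V' rule: rev_cases)
    case Nil
    then show ?thesis by (intro exI[of _ "[]"] exI[of _ 0]) simp
  next
    case (snoc X y)
    have "set (butlast (V1 @ V' @ V2)) \<subseteq> {1}"
      using constant_c1_image[of \<tau> "[a]" j] assms True V by simp
    then have "set X \<subseteq> {1}" using snoc by (auto simp: butlast_append split: if_splits)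
    then have "X = replicate (length X) 1" by (intro replicate_eqI) auto
    then have "V' = [] @ replicate (length X) 1 @ [y] \<and> length ([] :: word) \<le> 1 \<and> length [y] \<le> 1"
      using snoc by simp
    then show ?thesis by blast
  qed
  then show ?thesis by blast
next
  case False
  have "\<exists>P i Q. V' = P @ replicate i 3 @ Q \<and> length P \<le> 1 \<and> length Q \<le> 1"
    if V: "subst_prod \<tau> j [a] = V1 @ V' @ V2" for j a V1 V' V2
  proof (cases V')
    case Nil
    then show ?thesis by (intro exI[of _ "[]"] exI[of _ 0]) simp
  next
    case (Cons y X)
    have "set (tl (V1 @ V' @ V2)) \<subseteq> {3}"
      using constant_c2_image[of \<tau> "[a]" j] assms False V by simp
    then have "set X \<subseteq> {3}" using Cons by (cases V1) auto
    then have "X = replicate (length X) 3" by (intro replicate_eqI) auto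
    then have "V' = [y] @ replicate (length X) 3 @ [] \<and> length [y] \<le> 1 \<and> length ([] :: word) \<le> 1"
      using Cons by simp
    then show ?thesis by blast
  qed
  then show ?thesis by blast
qed

section \<open>Windows of adic words\<close>

lemma C_adic_directive: "C_adic \<sigma> w \<Longrightarrow> \<sigma> n \<in> {c1, c2}"
  by (simp add: C_adic_def)

text \<open>The window lies in a prefix of some long image, which is cut along the images of letters
  at level \<open>n\<close>. That \<open>V'\<close> is a factor of an image of one letter is what
  the eventually constant case uses.\<close>

lemma C_adic_window:
  assumes "C_adic \<sigma> w" and C: "\<forall>b. length (subst_prod \<sigma> n [b]) \<le> C"
  shows "\<exists>j a V1 V' V2 t1 t2. subst_prod (\<lambda>i. \<sigma> (n + i)) j [a] = V1 @ V' @ V2 \<and>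
    map w [k..<k + N] = t1 @ subst_prod \<sigma> n V' @ t2 \<and> length t1 \<le> C \<and> length t2 \<le> C"
proof -
  have \<sigma>: "\<sigma> i \<in> {c1, c2}" for i by (rule C_adic_directive[OF assms(1)])
  obtain a where "words_tendsto (\<lambda>n. subst_prod \<sigma> n [a n]) w"
    using assms(1) unfolding C_adic_def by blast
  then obtain m0 where m0: "\<And>m. m \<ge> m0 \<Longrightarrow> take (k + N) (subst_prod \<sigma> m [a m]) = map w [0..<k + N]"
    unfolding words_tendsto_def eventually_sequentially by blast
  \<comment> \<open>At least \<open>n\<close>, so that the first \<open>n\<close> substitutions
    split off, and at least \<open>m0\<close>, so that the prefix is correct.\<close>
  define m where "m = max n m0"
  define j where "j = m - n"
  define U where "U = subst_prod (\<lambda>i. \<sigma> (n + i)) j [a m]"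
  have mj: "m = n + j" by (simp add: j_def m_def)
  have "subst_prod \<sigma> m [a m] = subst_prod \<sigma> n U"
    unfolding mj U_def using subst_prod_add[of \<sigma>, OF \<sigma>, of n j] by simp
  also have "\<dots> = concat (map (\<lambda>b. subst_prod \<sigma> n [b]) U)"
    by (rule subst_prod_concat[of \<sigma>, OF \<sigma>])
  finally have "concat (map (\<lambda>b. subst_prod \<sigma> n [b]) U) =
      map w [0..<k + N] @ drop (k + N) (subst_prod \<sigma> m [a m])"
    using m0[of m] append_take_drop_id[of "k + N" "subst_prod \<sigma> m [a m]"] by (simp add: m_def)
  moreover have "map w [0..<k + N] = map w [0..<k] @ map w [k..<k + N]"
    using upt_add_eq_append[of 0 k N] by simp
  ultimately have "concat (map (\<lambda>b. subst_prod \<sigma> n [b]) U) =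
      map w [0..<k] @ map w [k..<k + N] @ drop (k + N) (subst_prod \<sigma> m [a m])"
    by simp
  from factor_concat_blocks[OF this C]
  obtain V1 V' V2 t1 t2 where "U = V1 @ V' @ V2"
    "map w [k..<k + N] = t1 @ concat (map (\<lambda>b. subst_prod \<sigma> n [b]) V') @ t2"
    "length t1 \<le> C" "length t2 \<le> C" by blast
  then show ?thesis
    unfolding U_def subst_prod_concat[of \<sigma>, OF \<sigma>, of n V', symmetric] by blast
qed

lemma letter_images_bounded: "\<exists>C. \<forall>b. length (subst_prod \<sigma> n [b :: letter]) \<le> C"
  by (rule exI[of _ "Max (range (\<lambda>b. length (subst_prod \<sigma> n [b])))"]) (auto intro: Max_ge)

lemma C_adic_uniform_word_frequencies:
  assumes "C_adic \<sigma> w"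
  shows "uniform_word_frequencies w"
proof (rule uniform_word_frequencies_blocks)
  fix u :: word and \<epsilon> :: real
  assume "\<epsilon> > 0"
  have \<sigma>: "\<sigma> i \<in> {c1, c2}" for i by (rule C_adic_directive[OF assms])
  show "\<exists>L C. \<forall>k N. \<exists>t1 Bs t2.
     map w [k..<k + N] = t1 @ concat Bs @ t2 \<and> length t1 \<le> C \<and> length t2 \<le> C \<and>
     (\<forall>B\<in>set Bs. good_block u \<epsilon> L B)"
  proof (cases "\<forall>n. \<exists>m\<ge>n. \<sigma> m \<noteq> \<sigma> (Suc m)")
    case True
    then obtain n L where good: "\<And>b. good_block u \<epsilon> L (subst_prod \<sigma> n [b])"
      using good_blocks[of \<sigma>, OF \<sigma> _ \<open>\<epsilon> > 0\<close>, of u] by blast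
    obtain C where C: "\<forall>b. length (subst_prod \<sigma> n [b]) \<le> C"
      using letter_images_bounded by blast
    have "\<exists>t1 Bs t2. map w [k..<k + N] = t1 @ concat Bs @ t2 \<and> length t1 \<le> C \<and> length t2 \<le> C \<and>
        (\<forall>B\<in>set Bs. good_block u \<epsilon> L B)" for k N
    proof -
      obtain V' t1 t2 where w: "map w [k..<k + N] = t1 @ subst_prod \<sigma> n V' @ t2"
        and t: "length t1 \<le> C" "length t2 \<le> C"
        using C_adic_window[OF assms C, of k N] by blast
      have "subst_prod \<sigma> n V' = concat (map (\<lambda>b. subst_prod \<sigma> n [b]) V')"
        by (rule subst_prod_concat[of \<sigma>, OF \<sigma>])
      moreover have "\<forall>B\<in>set (map (\<lambda>b. subst_prod \<sigma> n [b]) V'). good_block u \<epsilon> L B"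
        using good by auto
      ultimately show ?thesis using w t by metis
    qed
    then show ?thesis by blast
  next
    case False
    then obtain n where n: "\<And>m. m \<ge> n \<Longrightarrow> \<sigma> m = \<sigma> (Suc m)" by blast
    have const: "\<sigma> (n + i) = \<sigma> n" for i
      using n[of "n + i" for i] by (induction i) auto
    obtain b where b: "\<And>j a V1 V' V2. subst_prod (\<lambda>i. \<sigma> (n + i)) j [a] = V1 @ V' @ V2 \<Longrightarrow>
        \<exists>P i Q. V' = P @ replicate i b @ Q \<and> length P \<le> 1 \<and> length Q \<le> 1"
      using constant_image_factor[of "\<sigma> n" "\<lambda>i. \<sigma> (n + i)", OF \<sigma> const] by blast
    obtain r L where r: "0 < r" and good: "good_block u \<epsilon> L (subst_prod \<sigma> n (replicate r b))"
      using periodic_good_block[of \<sigma>, OF \<sigma> \<open>\<epsilon> > 0\<close>, of u n b] by blast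
    obtain C where C: "\<forall>b. length (subst_prod \<sigma> n [b]) \<le> C"
      using letter_images_bounded by blast
    have len: "length (subst_prod \<sigma> n V) \<le> C * length V" for V
      by (rule length_subst_prod_le[of \<sigma>, OF \<sigma>]) (use C in blast)
    \<comment> \<open>The ends absorb the cut blocks, the images of the exceptional letters (each at
      most \<open>C\<close>), and the image of the incomplete power (at most
      \<open>C * r\<close>).\<close>
    have "\<exists>t1 Bs t2. map w [k..<k + N] = t1 @ concat Bs @ t2 \<and>
        length t1 \<le> 2 * C + C * r \<and> length t2 \<le> 2 * C + C * r \<and>
        (\<forall>B\<in>set Bs. good_block u \<epsilon> L B)" for k N
    proof -
      obtain j a V1 V' V2 t1 t2 where V: "subst_prod (\<lambda>i. \<sigma> (n + i)) j [a] = V1 @ V' @ V2"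
        and w: "map w [k..<k + N] = t1 @ subst_prod \<sigma> n V' @ t2"
        and t: "length t1 \<le> C" "length t2 \<le> C"
        using C_adic_window[OF assms C, of k N] by blast
      obtain P i Q where V': "V' = P @ replicate i b @ Q" and PQ: "length P \<le> 1" "length Q \<le> 1"
        using b[OF V] by blast
      define s where "s = subst_prod \<sigma> n"
      \<comment> \<open>The power of \<open>b\<close> is grouped into powers of exponent
        \<open>r\<close>; this is the remainder.\<close>
      let ?R = "replicate (i mod r) b"
      have rep: "concat (replicate q (replicate r b)) = replicate (q * r) b" for q
        by (induction q) (simp_all add: replicate_add)
      have "replicate i b = concat (replicate (i div r) (replicate r b)) @ ?R"
        unfolding rep replicate_add[symmetric] by simp
      then have "subst_prod \<sigma> n V' =
          s P @ concat (replicate (i div r) (s (replicate r b))) @ s ?R @ s Q"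
        unfolding V' s_def
        by (simp add: subst_prod_append[of \<sigma>, OF \<sigma>] subst_prod_concat_replicate[of \<sigma>, OF \<sigma>])
      then have "map w [k..<k + N] = (t1 @ s P) @
          concat (replicate (i div r) (s (replicate r b))) @ (s ?R @ s Q @ t2)"
        using w by simp
      moreover have "length (s P) \<le> C" "length (s Q) \<le> C"
        using len[of P] len[of Q] PQ mult_le_mono2[of _ 1 C] unfolding s_def
        by (metis mult.right_neutral order_trans)+
      moreover have "length (s ?R) \<le> C * r"
        unfolding s_def using r by (intro order_trans[OF len]) (simp add: mod_le_divisor)
      ultimately show ?thesis
        using t good unfolding s_def[symmetric]
        by (intro exI[of _ "t1 @ s P"] exI[of _ "replicate (i div r) (s (replicate r b))"]
            exI[of _ "s ?R @ s Q @ t2"]) auto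
    qed
    then show ?thesis by blast
  qed
qed

section \<open>The letter frequency vector\<close>

lemma uniform_word_frequencies_letter:
  assumes "uniform_word_frequencies w"
  shows "\<exists>g. is_letter_frequency_vector w g"
proof -
  have "\<exists>l. (\<lambda>n. real (occ [a] (map w [0..<n])) / real n) \<longlonglongrightarrow> l" for a
  proof -
    obtain l :: real where "uniform_limit UNIV
        (\<lambda>n k. real (occ [a] (map w [k..<k + n])) / real n) (\<lambda>k. l) sequentially"
      using assms unfolding uniform_word_frequencies_def by blast
    from tendsto_uniform_limitI[OF this, of 0] show ?thesis by auto
  qed
  then obtain g where "\<And>a. (\<lambda>n. real (occ [a] (map w [0..<n])) / real n) \<longlonglongrightarrow> g a"
    by metis
  then have "is_letter_frequency_vector w (\<chi> a. g a)"
    by (simp add: is_letter_frequency_vector_def)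
  then show ?thesis by blast
qed

text \<open>The Parikh vector.\<close>

definition abelianization :: "word \<Rightarrow> real ^ letter" where
  "abelianization v = (\<chi> a. real (count_list v a))"

lemma abelianization_append: "abelianization (u @ v) = abelianization u + abelianization v"
  by (simp add: abelianization_def vec_eq_iff)

text \<open>By additivity single letters suffice, and column \<open>b\<close> of the incidence
  matrix is the Parikh vector of the image of \<open>b\<close>.\<close>

lemma abelianization_subst_prod:
  assumes \<sigma>: "\<And>n. \<sigma> n \<in> {c1, c2}"
  shows "abelianization (subst_prod \<sigma> n V) = incidence (subst_prod \<sigma> n) *v abelianization V"
proof (induction V)
  case Nil
  then show ?case
    by (simp add: subst_prod_Nil[of \<sigma>, OF \<sigma>] abelianization_def incidence_def
        matrix_vector_mult_def vec_eq_iff)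
next
  case (Cons b V)
  have "abelianization (subst_prod \<sigma> n [b]) = incidence (subst_prod \<sigma> n) *v abelianization [b]"
    by (simp add: abelianization_def incidence_def matrix_vector_mult_def vec_eq_iff
        occ_singleton if_distrib cong: if_cong)
  then have "abelianization (subst_prod \<sigma> n ([b] @ V)) =
      incidence (subst_prod \<sigma> n) *v abelianization ([b] @ V)"
    unfolding subst_prod_append[of \<sigma>, OF \<sigma>] abelianization_append
    using Cons by (simp add: matrix_vector_right_distrib)
  then show ?case by simp
qed

lemma abelianization_sum: "(\<Sum>a\<in>UNIV. abelianization v $ a) = real (length v)"
proof -
  have "(\<Sum>a\<in>UNIV. real (count_list v a)) = real (length v)"
    by (induction v) (simp_all add: sum_3, use exhaust_3 in force)
  then show ?thesis by (simp add: abelianization_def)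
qed

text \<open>A prefix of \<open>w\<close> is, up to bounded ends, an image under the product. After
  division by \<open>N\<close> its Parikh vector is the matrix applied to a point of the unit cube,
  plus a term tending to 0; the image of the cube is compact and so contains the limit.\<close>

lemma letter_frequencies_in_cone:
  assumes w: "C_adic \<sigma> w" and g: "is_letter_frequency_vector w g"
  shows "g \<in> (\<lambda>x. incidence (subst_prod \<sigma> n) *v x) ` nonneg_orthant"
proof -
  have \<sigma>: "\<sigma> i \<in> {c1, c2}" for i by (rule C_adic_directive[OF w])
  let ?M = "\<lambda>x. incidence (subst_prod \<sigma> n) *v x"
  obtain C where C: "\<forall>b. length (subst_prod \<sigma> n [b]) \<le> C"
    using letter_images_bounded by blast
  have "\<exists>V t1 t2. map w [0..<N] = t1 @ subst_prod \<sigma> n V @ t2 \<and>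
      length t1 \<le> C \<and> length t2 \<le> C" for N
    using C_adic_window[OF w C, of 0 N] unfolding add_0 by blast
  then obtain V t1 t2 where wN: "\<And>N. map w [0..<N] = t1 N @ subst_prod \<sigma> n (V N) @ t2 N"
    and t: "\<And>N. length (t1 N) \<le> C" "\<And>N. length (t2 N) \<le> C"
    by metis
  define x where "x N = (1 / real N) *\<^sub>R abelianization (V N)" for N
  define z where "z N = (1 / real N) *\<^sub>R (abelianization (t1 N) + abelianization (t2 N))" for N
  have count_le: "real (count_list v a) \<le> real (length v)" for v :: word and a
    by (simp add: count_le_length)
  have x: "x N \<in> cbox 0 1" for N
  proof -
    \<comment> \<open>Substitutions do not shorten words, which keeps \<open>x N\<close> in the unit
      cube.\<close>
    have "length (V N) \<le> length (map w [0..<N])"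
      unfolding wN using length_subst_prod_ge[of \<sigma>, OF \<sigma>, of "V N" n] by simp
    then have "real (count_list (V N) a) \<le> real N" for a
      using count_le[of "V N" a] by simp
    then show ?thesis
      by (auto simp: mem_box_cart x_def abelianization_def divide_le_eq_1)
  qed
  have "z \<longlonglongrightarrow> 0"
  proof (rule vec_tendstoI)
    fix a
    have "(\<lambda>N. z N $ a) \<longlonglongrightarrow> 0"
    proof (rule tendsto_sandwich[OF _ _ tendsto_const lim_const_over_n[of "2 * real C"]])
      have "z N $ a \<le> 2 * real C / real N" for N
        using count_le[of "t1 N" a] count_le[of "t2 N" a] t[of N]
        by (auto simp: z_def abelianization_def intro!: divide_right_mono)
      then show "\<forall>\<^sub>F N in sequentially. z N $ a \<le> 2 * real C / real N" by simp
    qed (simp add: z_def abelianization_def)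
    then show "(\<lambda>N. z N $ a) \<longlonglongrightarrow> 0 $ a" by simp
  qed
  moreover have "(\<lambda>N. (1 / real N) *\<^sub>R abelianization (map w [0..<N])) \<longlonglongrightarrow> g"
    by (rule vec_tendstoI)
      (use g in \<open>simp add: is_letter_frequency_vector_def occ_singleton abelianization_def\<close>)
  ultimately have "(\<lambda>N. (1 / real N) *\<^sub>R abelianization (map w [0..<N]) - z N) \<longlonglongrightarrow> g - 0"
    by (intro tendsto_diff)
  moreover have "(1 / real N) *\<^sub>R abelianization (map w [0..<N]) - z N = ?M (x N)" for N
    unfolding wN abelianization_append abelianization_subst_prod[OF \<sigma>] x_def z_def
    by (simp add: matrix_vector_mult_scaleR algebra_simps)
  ultimately have lim: "(\<lambda>N. ?M (x N)) \<longlonglongrightarrow> g" by simp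
  have "continuous_on (cbox 0 1) ?M"
    by (intro linear_continuous_on matrix_vector_mul_bounded_linear)
  then have "closed (?M ` cbox 0 1)"
    by (intro compact_imp_closed compact_continuous_image compact_cbox)
  then have "g \<in> ?M ` cbox 0 1"
    by (rule closed_sequentially[OF _ _ lim]) (use x in blast)
  moreover have "cbox 0 1 \<subseteq> nonneg_orthant"
    by (auto simp: nonneg_orthant_def mem_box_cart)
  ultimately show ?thesis by blast
qed

lemma letter_frequencies_sum:
  assumes "is_letter_frequency_vector w g"
  shows "(\<Sum>a\<in>UNIV. g $ a) = 1"
proof -
  have "(\<lambda>n. \<Sum>a\<in>UNIV. real (occ [a] (map w [0..<n])) / real n) \<longlonglongrightarrow> (\<Sum>a\<in>UNIV. g $ a)"
    using assms unfolding is_letter_frequency_vector_def by (intro tendsto_sum) blast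
  moreover have "(\<Sum>a\<in>UNIV. real (occ [a] (map w [0..<n])) / real n) = 1" if "n > 0" for n
    using abelianization_sum[of "map w [0..<n]"] that
    by (simp add: occ_singleton abelianization_def flip: sum_divide_distrib)
  then have "(\<lambda>n. \<Sum>a\<in>UNIV. real (occ [a] (map w [0..<n])) / real n) \<longlonglongrightarrow> 1"
    by (intro tendsto_eventually eventually_mono[OF eventually_gt_at_top[of 0]])
  ultimately show ?thesis by (rule LIMSEQ_unique)
qed

theorem proposition7p1:
  fixes \<sigma> :: "nat \<Rightarrow> subst" and w :: "nat \<Rightarrow> letter"
  assumes "C_adic \<sigma> w"
  shows "uniform_word_frequencies w \<and>
    (\<forall>f \<in> nonneg_orthant. (\<Sum>a\<in>UNIV. \<bar>f $ a\<bar>) = 1 \<longrightarrow>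
       (\<Inter>n. (\<lambda>x. incidence (subst_prod \<sigma> n) *v x) ` nonneg_orthant) = {t *\<^sub>R f |t. 0 \<le> t} \<longrightarrow>
       is_letter_frequency_vector w f)"
proof (intro conjI ballI impI)
  show unif: "uniform_word_frequencies w"
    by (rule C_adic_uniform_word_frequencies[OF assms])
  fix f :: "real ^ letter"
  assume f: "f \<in> nonneg_orthant" and f1: "(\<Sum>a\<in>UNIV. \<bar>f $ a\<bar>) = 1"
    and cone: "(\<Inter>n. (\<lambda>x. incidence (subst_prod \<sigma> n) *v x) ` nonneg_orthant)
      = {t *\<^sub>R f |t. 0 \<le> t}"
  obtain g where g: "is_letter_frequency_vector w g"
    using uniform_word_frequencies_letter[OF unif] by blast
  have "g \<in> (\<Inter>n. (\<lambda>x. incidence (subst_prod \<sigma> n) *v x) ` nonneg_orthant)"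
    using letter_frequencies_in_cone[OF assms g] by blast
  then obtain t where t: "g = t *\<^sub>R f" unfolding cone by blast
  \<comment> \<open>Both \<open>f\<close> and \<open>g\<close> have coordinate sum 1, which fixes
    the factor \<open>t\<close>.\<close>
  have "(\<Sum>a\<in>UNIV. f $ a) = 1" using f f1 by (simp add: nonneg_orthant_def)
  then have "t = 1"
    using letter_frequencies_sum[OF g] unfolding t by (simp flip: sum_distrib_left)
  then show "is_letter_frequency_vector w f" using g t by simp
qed

end
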